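(* In CCSK extended with replication, with its proved labelled transition system, for all (reachable) processes $X,X_1,Y$ and enhanced keyed labels $\theta_1,\theta_2$ with $X\xrightarrow{\theta_1}X_1\xrightarrow{\theta_2}Y$ and $\theta_1\smile\theta_2$ (in this trace), there exist a process $X_2$ and labels $\hat\theta_1,\hat\theta_2$ such that $X\xrightarrow{\hat\theta_2}X_2\xrightarrow{\hat\theta_1}Y$ and $\sigma(\hat\theta_i)=\sigma(\theta_i)$ for $i\in\{1,2\}$.
   Context: **Syntax.** Let $\mathsf N=\{a,b,c,\dots\}$ be a set of names, $\overline{\mathsf N}=\{\bar a,\bar b,\bar c,\dots\}$ the set of co-names, with a bijection $\overline{\,\cdot\,}:\mathsf N\to\overline{\mathsf N}$ whose inverse is also written $\overline{\,\cdot\,}$. Labels: $\mathsf L=\mathsf N\cup\overline{\mathsf N}\cup\{\tau\}$; $\alpha,\beta$ range over $\mathsf L$ and $\lambda$ over $\mathsf L\setminus\{\tau\}$. Let $\mathsf K=\{m,n,\dots\}$ be a set of keys, ranged over by $k$. Processes of CCSK with replication: $X,Y ::= 0 \mid \alpha.X \mid \alpha[k].X \mid X\backslash a \mid X+Y \mid (X\mid Y)\mid\ !X$. $\mathrm{key}(X)$ is the set of keys occurring in $X$; $X$ is standard, $\mathrm{std}(X)$, iff $\mathrm{key}(X)=\emptyset$. **Enhanced keyed labels.** With $\upsilon,\upsilon_L,\upsilon_R$ strings in $\{|_L,|_R,!\}^*$: $\theta ::= \upsilon\alpha[k]$ or $\upsilon\langle |_L\upsilon_L\alpha[k],\ |_R\upsilon_R\bar\alpha[k]\rangle$.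 Put $\ell(\upsilon\alpha[k])=\alpha$, $\ell$ of the second form $=\tau$, and $\kappa(\theta)=k$ in both cases. **Proved LTS.** Forward transitions $X\xrightarrow{\theta}X'$ are inductively generated by: - (act.) $\alpha.X\xrightarrow{\alpha[k]}\alpha[k].X$ if $\mathrm{std}(X)$; - (pre.) $\alpha[k].X\xrightarrow{\theta}\alpha[k].X'$ if $X\xrightarrow{\theta}X'$ and $\kappa(\theta)\neq k$; - (res.) $X\backslash a\xrightarrow{\theta}X'\backslash a$ if $X\xrightarrow{\theta}X'$ and $\ell(\theta)\notin\{a,\bar a\}$; - ($|_L$) $X\mid Y\xrightarrow{|_L\theta}X'\mid Y$ if $X\xrightarrow{\theta}X'$ and $\kappa(\theta)\notin\mathrm{key}(Y)$; ($|_R$) symmetrically, $X\mid Y\xrightarrow{|_R\theta}X\mid Y'$ if $Y\xrightarrow{\theta}Y'$ and $\kappa(\theta)\notin\mathrm{key}(X)$; - (syn.) $X\mid Y\xrightarrow{\langle |_L\upsilon_L\lambda[k],\,|_R\upsilon_R\bar\lambda[k]\rangle}X'\mid Y'$ if $X\xrightarrow{\upsilon_L\lambda[k]}X'$ and $Y\xrightarrow{\upsilon_R\bar\lambda[k]}Y'$; - ($+_L$) $X+Y\xrightarrow{\theta}X'+Y$ if $X\xrightarrow{\theta}X'$ and $\mathrm{std}(Y)$; ($+_R$) symmetrically; - (repl.$_1$) $!X\xrightarrow{!\theta}\ !X\mid X'$ if $X\xrightarrow{\theta}X'$; - (repl.$_2$) $!X\xrightarrow{!\langle|_L\upsilon_L\lambda[k],\,|_R\upsilon_R\bar\lambda[k]\rangle}\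 !X\mid(X'\mid X'')$ if $X\xrightarrow{\upsilon_L\lambda[k]}X'$ and $X\xrightarrow{\upsilon_R\bar\lambda[k]}X''$. Backward transitions $X'\overset{\theta}{\rightsquigarrow}X$ are generated by the exact symmetric rules (source and target exchanged in premises and conclusion, same labels and side conditions). Write $X\overset{\theta}{\twoheadrightarrow}Y$ if $X\xrightarrow{\theta}Y$ or $X\overset{\theta}{\rightsquigarrow}Y$. A process $X$ is reachable if there is a standard $O_X$ from which $X$ is reached by a finite sequence of $\twoheadrightarrow$-steps. All processes considered are reachable. There is no structural congruence. **Dependency and concurrency.** The dependency relation $\lessdot$ on enhanced keyed labels is induced by (is the least relation satisfying), for $d\in\{L,R\}$: $\alpha[k]\lessdot\theta$ for every $\theta$; $|_d\theta\lessdot|_d\theta'$ if $\theta\lessdot\theta'$; $\langle\theta_L,\theta_R\rangle\lessdot\theta$ if $\theta_d\lessdot\theta$ for some $d$; $\theta\lessdot\langle\theta_L,\theta_R\rangle$ if $\theta\lessdot\theta_d$ for some $d$; $\langle\theta_L,\theta_R\rangle\lessdot\langle\theta_L',\theta_R'\rangle$ if $\theta_d\lessdot\theta_d'$ for some $d$ (here $\theta_L,\theta_R$ include their leading $|_L$, $|_R$); $!\theta\lessdot\,!\theta$; $!\theta\lessdot|_L\theta'$ for all $\theta,\theta'$; and $!\theta\lessdot|_R\theta'$ if either $\theta=\langle\theta_L,\theta_R\rangle$ and $\theta'=|_L\theta''$, or $\theta=\langle\theta_L,\theta_R\rangle$ and $\theta'=|_R\theta''$, or, otherwise, $\theta\lessdot\theta'$.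 In a trace $T:X_1\overset{\theta_1}{\twoheadrightarrow}\cdots\overset{\theta_n}{\twoheadrightarrow}X_{n+1}$, for $i<j$, $\theta_i\lessdot_T\theta_j$ iff $\theta_i\lessdot\theta_j$; and $\theta_i\smile_T\theta_j$ (written also $\theta_i\smile\theta_j$; "concurrent") iff neither $\theta_i\lessdot_T\theta_j$ nor $\theta_j\lessdot_T\theta_i$. Thus for $i<j$, $\theta_i\smile_T\theta_j$ iff not $\theta_i\lessdot\theta_j$. **Collapsing function.** $\sigma$ is defined on labels by $\sigma(\alpha[k])=\alpha[k]$, $\sigma(|_d\theta)=|_d\sigma(\theta)$ for $d\in\{L,R\}$, $\sigma(!\theta)=|_R\sigma(\theta)$, $\sigma(\langle\theta_L,\theta_R\rangle)=\langle\sigma(\theta_L),\sigma(\theta_R)\rangle$. *)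

theory Defs
  imports Main
begin

datatype 'n visible = Nm 'n | Conm 'n

datatype 'n action = Vis "'n visible" | Tau

primrec co :: "'n visible \<Rightarrow> 'n visible" where
  "co (Nm a) = Conm a"
| "co (Conm a) = Nm a"

datatype ('n, 'k) proc =
    Inert
  | Prefix "'n action" "('n, 'k) proc"
  | KPrefix "'n action" 'k "('n, 'k) proc"
  | Restrict "('n, 'k) proc" 'n
  | Sum "('n, 'k) proc" "('n, 'k) proc"
  | Par "('n, 'k) proc" "('n, 'k) proc"
  | Repl "('n, 'k) proc"

primrec keys :: "('n, 'k) proc \<Rightarrow> 'k set" where
  "keys Inert = {}"
| "keys (Prefix \<alpha> X) = keys X"
| "keys (KPrefix \<alpha> k X) = insert k (keys X)"
| "keys (Restrict X a) = keys X"
| "keys (Sum X Y) = keys X \<union> keys Y"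
| "keys (Par X Y) = keys X \<union> keys Y"
| "keys (Repl X) = keys X"

definition std :: "('n, 'k) proc \<Rightarrow> bool" where
  "std X \<longleftrightarrow> keys X = {}"

datatype tag = ParL | ParR | Bang

text \<open>
  The type is larger than the set of enhanced keyed labels: the two components of \<open>Sync\<close> are
  meant to carry their leading \<open>ParL\<close> and \<open>ParR\<close>, and to end in complementary visible actions with
  the same key. The predicate \<open>enhanced\<close> below carves out the intended labels, and all labels of
  transitions satisfy it.
\<close>

datatype ('n, 'k) elabel =
    Act "'n action" 'k
  | Tag tag "('n, 'k) elabel"
  | Sync "('n, 'k) elabel" "('n, 'k) elabel"

abbreviation tagged :: "tag list \<Rightarrow> 'n action \<Rightarrow> 'k \<Rightarrow> ('n, 'k) elabel" where
  "tagged \<upsilon> \<alpha> k \<equiv> foldr Tag \<upsilon> (Act \<alpha> k)"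

abbreviation sync :: "tag list \<Rightarrow> tag list \<Rightarrow> 'n visible \<Rightarrow> 'k \<Rightarrow> ('n, 'k) elabel" where
  "sync \<upsilon>L \<upsilon>R l k \<equiv>
     Sync (Tag ParL (tagged \<upsilon>L (Vis l) k)) (Tag ParR (tagged \<upsilon>R (Vis (co l)) k))"

inductive enhanced :: "('n, 'k) elabel \<Rightarrow> bool" where
  "enhanced (tagged \<upsilon> \<alpha> k)"
| "enhanced (foldr Tag \<upsilon> (sync \<upsilon>L \<upsilon>R l k))"

primrec lab :: "('n, 'k) elabel \<Rightarrow> 'n action" where
  "lab (Act \<alpha> k) = \<alpha>"
| "lab (Tag t \<theta>) = lab \<theta>"
| "lab (Sync \<theta>L \<theta>R) = Tau"

text \<open>Both components of an enhanced \<open>Sync\<close> label have the same key, so the choice of the left one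
  is immaterial.\<close>

primrec key :: "('n, 'k) elabel \<Rightarrow> 'k" where
  "key (Act \<alpha> k) = k"
| "key (Tag t \<theta>) = key \<theta>"
| "key (Sync \<theta>L \<theta>R) = key \<theta>L"

inductive fwd :: "('n, 'k) proc \<Rightarrow> ('n, 'k) elabel \<Rightarrow> ('n, 'k) proc \<Rightarrow> bool" where
  act: "std X \<Longrightarrow> fwd (Prefix \<alpha> X) (Act \<alpha> k) (KPrefix \<alpha> k X)"
| pre: "fwd X \<theta> X' \<Longrightarrow> key \<theta> \<noteq> k \<Longrightarrow> fwd (KPrefix \<alpha> k X) \<theta> (KPrefix \<alpha> k X')"
| res: "fwd X \<theta> X' \<Longrightarrow> lab \<theta> \<notin> {Vis (Nm a), Vis (Conm a)} \<Longrightarrow>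
    fwd (Restrict X a) \<theta> (Restrict X' a)"
| parL: "fwd X \<theta> X' \<Longrightarrow> key \<theta> \<notin> keys Y \<Longrightarrow> fwd (Par X Y) (Tag ParL \<theta>) (Par X' Y)"
| parR: "fwd Y \<theta> Y' \<Longrightarrow> key \<theta> \<notin> keys X \<Longrightarrow> fwd (Par X Y) (Tag ParR \<theta>) (Par X Y')"
| syn: "fwd X (tagged \<upsilon>L (Vis l) k) X' \<Longrightarrow> fwd Y (tagged \<upsilon>R (Vis (co l)) k) Y' \<Longrightarrow>
    fwd (Par X Y) (sync \<upsilon>L \<upsilon>R l k) (Par X' Y')"
| sumL: "fwd X \<theta> X' \<Longrightarrow> std Y \<Longrightarrow> fwd (Sum X Y) \<theta> (Sum X' Y)"
| sumR: "fwd Y \<theta> Y' \<Longrightarrow> std X \<Longrightarrow> fwd (Sum X Y) \<theta> (Sum X Y')"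
| repl1: "fwd X \<theta> X' \<Longrightarrow> fwd (Repl X) (Tag Bang \<theta>) (Par (Repl X) X')"
| repl2: "fwd X (tagged \<upsilon>L (Vis l) k) X' \<Longrightarrow> fwd X (tagged \<upsilon>R (Vis (co l)) k) X'' \<Longrightarrow>
    fwd (Repl X) (Tag Bang (sync \<upsilon>L \<upsilon>R l k)) (Par (Repl X) (Par X' X''))"

inductive bwd :: "('n, 'k) proc \<Rightarrow> ('n, 'k) elabel \<Rightarrow> ('n, 'k) proc \<Rightarrow> bool" where
  act: "std X \<Longrightarrow> bwd (KPrefix \<alpha> k X) (Act \<alpha> k) (Prefix \<alpha> X)"
| pre: "bwd X' \<theta> X \<Longrightarrow> key \<theta> \<noteq> k \<Longrightarrow> bwd (KPrefix \<alpha> k X') \<theta> (KPrefix \<alpha> k X)"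
| res: "bwd X' \<theta> X \<Longrightarrow> lab \<theta> \<notin> {Vis (Nm a), Vis (Conm a)} \<Longrightarrow>
    bwd (Restrict X' a) \<theta> (Restrict X a)"
| parL: "bwd X' \<theta> X \<Longrightarrow> key \<theta> \<notin> keys Y \<Longrightarrow> bwd (Par X' Y) (Tag ParL \<theta>) (Par X Y)"
| parR: "bwd Y' \<theta> Y \<Longrightarrow> key \<theta> \<notin> keys X \<Longrightarrow> bwd (Par X Y') (Tag ParR \<theta>) (Par X Y)"
| syn: "bwd X' (tagged \<upsilon>L (Vis l) k) X \<Longrightarrow> bwd Y' (tagged \<upsilon>R (Vis (co l)) k) Y \<Longrightarrow>
    bwd (Par X' Y') (sync \<upsilon>L \<upsilon>R l k) (Par X Y)"
| sumL: "bwd X' \<theta> X \<Longrightarrow> std Y \<Longrightarrow> bwd (Sum X' Y) \<theta> (Sum X Y)"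
| sumR: "bwd Y' \<theta> Y \<Longrightarrow> std X \<Longrightarrow> bwd (Sum X Y') \<theta> (Sum X Y)"
| repl1: "bwd X' \<theta> X \<Longrightarrow> bwd (Par (Repl X) X') (Tag Bang \<theta>) (Repl X)"
| repl2: "bwd X' (tagged \<upsilon>L (Vis l) k) X \<Longrightarrow> bwd X'' (tagged \<upsilon>R (Vis (co l)) k) X \<Longrightarrow>
    bwd (Par (Repl X) (Par X' X'')) (Tag Bang (sync \<upsilon>L \<upsilon>R l k)) (Repl X)"

lemma enhanced_Tag: "enhanced \<theta> \<Longrightarrow> enhanced (Tag t \<theta>)"
  by (erule enhanced.cases) (metis enhanced.intros foldr.simps(2) o_apply)+

lemma enhanced_sync: "enhanced (sync \<upsilon>L \<upsilon>R l k)"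
  using enhanced.intros(2)[of "[]"] by simp

lemma enhanced_Act: "enhanced (Act \<alpha> k)"
  using enhanced.intros(1)[of "[]"] by simp

lemma fwd_enhanced: "fwd X \<theta> X' \<Longrightarrow> enhanced \<theta>"
  by (induction rule: fwd.induct) (simp_all add: enhanced_Act enhanced_sync enhanced_Tag)

lemma bwd_enhanced: "bwd X' \<theta> X \<Longrightarrow> enhanced \<theta>"
  by (induction rule: bwd.induct) (simp_all add: enhanced_Act enhanced_sync enhanced_Tag)

definition step :: "('n, 'k) proc \<Rightarrow> ('n, 'k) elabel \<Rightarrow> ('n, 'k) proc \<Rightarrow> bool" where
  "step X \<theta> Y \<longleftrightarrow> fwd X \<theta> Y \<or> bwd X \<theta> Y"

definition reachable :: "('n, 'k) proc \<Rightarrow> bool" where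
  "reachable X \<longleftrightarrow> (\<exists>O\<^sub>X. std O\<^sub>X \<and> (\<lambda>P Q. \<exists>\<theta>. step P \<theta> Q)\<^sup>*\<^sup>* O\<^sub>X X)"

text \<open>
  The last rule is applied without the proviso that the two preceding ones do not apply: when they
  do, the pair is related anyway, so the proviso does not change the relation. As all premises
  concern sublabels, the relation restricts on enhanced labels to the least relation on these.
\<close>

inductive dep :: "('n, 'k) elabel \<Rightarrow> ('n, 'k) elabel \<Rightarrow> bool" (infix \<open>\<lessdot>\<close> 50) where
  "Act \<alpha> k \<lessdot> \<theta>"
| "d \<in> {ParL, ParR} \<Longrightarrow> \<theta> \<lessdot> \<theta>' \<Longrightarrow> Tag d \<theta> \<lessdot> Tag d \<theta>'"
| "\<theta>L \<lessdot> \<theta> \<or> \<theta>R \<lessdot> \<theta> \<Longrightarrow> Sync \<theta>L \<theta>R \<lessdot> \<theta>"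
| "\<theta> \<lessdot> \<theta>L \<or> \<theta> \<lessdot> \<theta>R \<Longrightarrow> \<theta> \<lessdot> Sync \<theta>L \<theta>R"
| "\<theta>L \<lessdot> \<theta>L' \<or> \<theta>R \<lessdot> \<theta>R' \<Longrightarrow> Sync \<theta>L \<theta>R \<lessdot> Sync \<theta>L' \<theta>R'"
| "Tag Bang \<theta> \<lessdot> Tag Bang \<theta>"
| "Tag Bang \<theta> \<lessdot> Tag ParL \<theta>'"
| "Tag Bang (Sync \<theta>L \<theta>R) \<lessdot> Tag ParR (Tag ParL \<theta>'')"
| "Tag Bang (Sync \<theta>L \<theta>R) \<lessdot> Tag ParR (Tag ParR \<theta>'')"
| "\<theta> \<lessdot> \<theta>' \<Longrightarrow> Tag Bang \<theta> \<lessdot> Tag ParR \<theta>'"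

type_synonym ('n, 'k) transition = "('n, 'k) proc \<times> ('n, 'k) elabel \<times> ('n, 'k) proc"

fun trace :: "('n, 'k) transition list \<Rightarrow> bool" where
  "trace [] \<longleftrightarrow> True"
| "trace [(X, \<theta>, Y)] \<longleftrightarrow> step X \<theta> Y"
| "trace ((X, \<theta>, Y) # (X', \<theta>', Y') # T) \<longleftrightarrow> step X \<theta> Y \<and> Y = X' \<and> trace ((X', \<theta>', Y') # T)"

definition label_at :: "('n, 'k) transition list \<Rightarrow> nat \<Rightarrow> ('n, 'k) elabel" where
  "label_at T i = fst (snd (T ! i))"

text \<open>Positions in a trace are counted from \<open>0\<close>; they, rather than bare labels, identify the
  occurrences being compared.\<close>

definition dep_in :: "('n, 'k) transition list \<Rightarrow> nat \<Rightarrow> nat \<Rightarrow> bool" where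
  "dep_in T i j \<longleftrightarrow> i < j \<and> j < length T \<and> label_at T i \<lessdot> label_at T j"

definition concurrent_in :: "('n, 'k) transition list \<Rightarrow> nat \<Rightarrow> nat \<Rightarrow> bool" where
  "concurrent_in T i j \<longleftrightarrow> trace T \<and> i < length T \<and> j < length T \<and> i \<noteq> j \<and>
     \<not> dep_in T i j \<and> \<not> dep_in T j i"

primrec collapse :: "('n, 'k) elabel \<Rightarrow> ('n, 'k) elabel" where
  "collapse (Act \<alpha> k) = Act \<alpha> k"
| "collapse (Tag t \<theta>) = Tag (if t = Bang then ParR else t) (collapse \<theta>)"
| "collapse (Sync \<theta>L \<theta>R) = Sync (collapse \<theta>L) (collapse \<theta>R)"

end

theory Submission
  imports Defs
begin

text \<open>
  The square is closed by induction on the derivation of the first transition. A transition adds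
  exactly its own key, which is fresh, so the side conditions on keys survive the exchange. For a
  first step \<open>!\<theta>\<close> of \<open>!X\<close>, concurrency forces the second step into the copy just spawned. Exchanging
  the two inside the copy makes the formerly second step the one that unfolds the replication, so
  its prefix \<open>|\<^sub>R\<close> becomes \<open>!\<close> and that of the other changes from \<open>!\<close> to \<open>|\<^sub>R\<close>. The collapsing
  function identifies these two prefixes.
\<close>

section \<open>Keys of transitions and the shape of labels under collapsing\<close>

lemma key_tagged [simp]: "key (tagged \<upsilon> \<alpha> k) = k"
  by (induction \<upsilon>) auto

text \<open>Both facts come from one induction: the side conditions keep the key out of an idle
  context, and in a sum the idle side has no keys at all. A replication keeps its keys when
  unfolded, and the spawned copy adds just the new one.\<close>

lemma key_fresh: "fwd X \<theta> X' \<Longrightarrow> key \<theta> \<notin> keys X"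
  and keys_fwd: "fwd X \<theta> X' \<Longrightarrow> keys X' = insert (key \<theta>) (keys X)"
  by (induction rule: fwd.induct) (auto simp: std_def)

lemma key_collapse: "key (collapse \<theta>) = key \<theta>"
  by (induction \<theta>) auto

lemma lab_collapse: "lab (collapse \<theta>) = lab \<theta>"
  by (induction \<theta>) auto

text \<open>Collapsing renames tags but keeps every constructor, so only the tags of a preimage are
  free. This matters because \<open>syn\<close> and \<open>repl2\<close> accept no other shape of
  premise label, and the induction hypothesis gives labels only up to
  \<open>collapse\<close>.\<close>

lemma collapse_eq_tagged:
  assumes "collapse \<theta> = collapse (tagged \<upsilon> \<alpha> k)"
  obtains \<upsilon>' where "\<theta> = tagged \<upsilon>' \<alpha> k"
proof -
  have "\<exists>\<upsilon>'. \<theta> = tagged \<upsilon>' \<alpha> k"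
    using assms
  proof (induction \<upsilon> arbitrary: \<theta>)
    case Nil
    then show ?case by (cases \<theta>) (auto intro: exI[of _ "[]"])
  next
    case (Cons t \<upsilon>)
    then obtain s \<theta>' where "\<theta> = Tag s \<theta>'" "collapse \<theta>' = collapse (tagged \<upsilon> \<alpha> k)"
      by (cases \<theta>) auto
    moreover from Cons.IH[OF this(2)] obtain \<upsilon>' where "\<theta>' = tagged \<upsilon>' \<alpha> k" by blast
    ultimately show ?case by (auto intro: exI[of _ "s # \<upsilon>'"])
  qed
  with that show ?thesis by blast
qed

section \<open>Closing the square up to collapsing\<close>

definition swappable ::
  "('n, 'k) proc \<Rightarrow> ('n, 'k) elabel \<Rightarrow> ('n, 'k) elabel \<Rightarrow> ('n, 'k) proc \<Rightarrow> bool" where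
  "swappable X \<theta>\<^sub>1 \<theta>\<^sub>2 Y \<longleftrightarrow> (\<exists>X\<^sub>2 \<theta>\<^sub>1' \<theta>\<^sub>2'. fwd X \<theta>\<^sub>2' X\<^sub>2 \<and> fwd X\<^sub>2 \<theta>\<^sub>1' Y \<and>
     collapse \<theta>\<^sub>1' = collapse \<theta>\<^sub>1 \<and> collapse \<theta>\<^sub>2' = collapse \<theta>\<^sub>2)"

lemma swappableI:
  assumes "fwd X \<theta>\<^sub>2' X\<^sub>2" "fwd X\<^sub>2 \<theta>\<^sub>1' Y"
    "collapse \<theta>\<^sub>1' = collapse \<theta>\<^sub>1" "collapse \<theta>\<^sub>2' = collapse \<theta>\<^sub>2"
  shows "swappable X \<theta>\<^sub>1 \<theta>\<^sub>2 Y"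
  using assms unfolding swappable_def by blast

text \<open>The side conditions of \<open>pre\<close>, \<open>res\<close>, \<open>parL\<close> and
  \<open>parR\<close> inspect a label only through \<open>key\<close> and \<open>lab\<close>. As
  \<open>collapse\<close> preserves both, the conditions pass from the old labels to the new
  ones.\<close>

lemma swappableE:
  assumes "swappable X \<theta>\<^sub>1 \<theta>\<^sub>2 Y"
  obtains X\<^sub>2 \<theta>\<^sub>1' \<theta>\<^sub>2' where "fwd X \<theta>\<^sub>2' X\<^sub>2" "fwd X\<^sub>2 \<theta>\<^sub>1' Y"
    "collapse \<theta>\<^sub>1' = collapse \<theta>\<^sub>1" "collapse \<theta>\<^sub>2' = collapse \<theta>\<^sub>2"
    "key \<theta>\<^sub>1' = key \<theta>\<^sub>1" "key \<theta>\<^sub>2' = key \<theta>\<^sub>2" "lab \<theta>\<^sub>1' = lab \<theta>\<^sub>1" "lab \<theta>\<^sub>2' = lab \<theta>\<^sub>2"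
  using assms unfolding swappable_def by (metis key_collapse lab_collapse)

text \<open>Serves the case of two synchronisations: the new labels still carry complementary
  actions and a common key, so the halves can be synchronised again.\<close>

lemma swappable_taggedE:
  assumes "swappable X (tagged \<upsilon>\<^sub>1 \<alpha> k) (tagged \<upsilon>\<^sub>2 \<beta> k') Y"
  obtains X\<^sub>2 \<upsilon>\<^sub>1' \<upsilon>\<^sub>2' where
    "fwd X (tagged \<upsilon>\<^sub>2' \<beta> k') X\<^sub>2" "fwd X\<^sub>2 (tagged \<upsilon>\<^sub>1' \<alpha> k) Y"
    "collapse (tagged \<upsilon>\<^sub>1' \<alpha> k) = collapse (tagged \<upsilon>\<^sub>1 \<alpha> k)"
    "collapse (tagged \<upsilon>\<^sub>2' \<beta> k') = collapse (tagged \<upsilon>\<^sub>2 \<beta> k')"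
proof -
  from assms obtain X\<^sub>2 \<theta>\<^sub>1' \<theta>\<^sub>2' where *: "fwd X \<theta>\<^sub>2' X\<^sub>2" "fwd X\<^sub>2 \<theta>\<^sub>1' Y"
    "collapse \<theta>\<^sub>1' = collapse (tagged \<upsilon>\<^sub>1 \<alpha> k)" "collapse \<theta>\<^sub>2' = collapse (tagged \<upsilon>\<^sub>2 \<beta> k')"
    by (rule swappableE)
  moreover from *(3) obtain \<upsilon>\<^sub>1' where "\<theta>\<^sub>1' = tagged \<upsilon>\<^sub>1' \<alpha> k" by (rule collapse_eq_tagged)
  moreover from *(4) obtain \<upsilon>\<^sub>2' where "\<theta>\<^sub>2' = tagged \<upsilon>\<^sub>2' \<beta> k'" by (rule collapse_eq_tagged)
  ultimately show ?thesis using that by blast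
qed

section \<open>Exchange of two independent forward steps\<close>

lemma dep_ParL: "\<theta> \<lessdot> \<theta>' \<Longrightarrow> Tag ParL \<theta> \<lessdot> Tag ParL \<theta>'"
  and dep_ParR: "\<theta> \<lessdot> \<theta>' \<Longrightarrow> Tag ParR \<theta> \<lessdot> Tag ParR \<theta>'"
  by (simp_all add: dep.intros(2))

inductive_cases fwd_KPrefixE: "fwd (KPrefix \<alpha> k X) \<theta> Y"
inductive_cases fwd_RestrictE: "fwd (Restrict X a) \<theta> Y"
inductive_cases fwd_SumE: "fwd (Sum X Y) \<theta> Z"
inductive_cases fwd_ParE [consumes 1, case_names 1 2 3]: "fwd (Par X Y) \<theta> Z"

text \<open>Plain non-dependency is the form that passes to sublabels: each use of the induction
  hypothesis is justified by a \<open>dep\<close> rule that would lift a dependency of sublabels to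
  the whole labels.\<close>

lemma swap:
  assumes "fwd X \<theta>\<^sub>1 X\<^sub>1" "fwd X\<^sub>1 \<theta>\<^sub>2 Y" "\<not> \<theta>\<^sub>1 \<lessdot> \<theta>\<^sub>2"
  shows "swappable X \<theta>\<^sub>1 \<theta>\<^sub>2 Y"
  using assms
proof (induction arbitrary: \<theta>\<^sub>2 Y rule: fwd.induct)
  case (act X \<alpha> k)
  \<comment> \<open>An action without tags is below every label, so this case contradicts the
    assumption.\<close>
  then show ?case using dep.intros(1)[of \<alpha> k \<theta>\<^sub>2] by simp
next
  case (pre X \<theta> X' k \<alpha>)
  from pre.prems(1) obtain Y' where Y: "Y = KPrefix \<alpha> k Y'" "fwd X' \<theta>\<^sub>2 Y'" "key \<theta>\<^sub>2 \<noteq> k"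
    by (auto elim: fwd_KPrefixE)
  from pre.IH[OF Y(2) pre.prems(2)] show ?case
    by (rule swappableE) (use Y pre.hyps in \<open>fastforce intro: swappableI fwd.pre\<close>)
next
  case (res X \<theta> X' a)
  from res.prems(1) obtain Y' where Y: "Y = Restrict Y' a" "fwd X' \<theta>\<^sub>2 Y'"
      "lab \<theta>\<^sub>2 \<notin> {Vis (Nm a), Vis (Conm a)}"
    by (auto elim: fwd_RestrictE)
  from res.IH[OF Y(2) res.prems(2)] show ?case
    by (rule swappableE) (use Y res.hyps in \<open>fastforce intro: swappableI fwd.res\<close>)
next
  case (parL X \<theta> X' Z)
  from parL.prems(1) show ?case
  proof (cases rule: fwd_ParE)
    case (1 \<theta>' Y')
    have "\<not> \<theta> \<lessdot> \<theta>'"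
      using parL.prems(2) unfolding 1(1) by (rule contrapos_nn) (rule dep_ParL)
    from parL.IH[OF 1(3) this] show ?thesis
      unfolding 1(1,2)
      by (rule swappableE) (rule swappableI, erule fwd.parL, simp add: 1(4), erule fwd.parL,
        simp_all add: parL.hyps(2))
  next
    case (2 \<theta>' Z')
    \<comment> \<open>The steps lie in different components and keep their labels. The key of
      \<open>\<theta>'\<close> avoids \<open>X'\<close>, which contains \<open>key \<theta>\<close>;
      hence it avoids \<open>X\<close>, and the two keys differ.\<close>
    have "fwd (Par X Z) (Tag ParR \<theta>') (Par X Z')"
      using 2(3,4) keys_fwd[OF parL.hyps(1)] by (simp add: fwd.parR)
    moreover have "fwd (Par X Z') (Tag ParL \<theta>) (Par X' Z')"
      using 2(4) parL.hyps keys_fwd[OF parL.hyps(1)] keys_fwd[OF 2(3)] by (auto intro!: fwd.parL)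
    ultimately show ?thesis unfolding 2(1,2) by (rule swappableI) (rule refl)+
  next
    case (3 \<upsilon>L l k X'' \<upsilon>R Z')
    \<comment> \<open>Only the left half of the synchronisation is exchanged with \<theta>; the
      right half is carried along unchanged.\<close>
    have "\<not> \<theta> \<lessdot> tagged \<upsilon>L (Vis l) k"
      using parL.prems(2) unfolding 3(1) by (rule contrapos_nn) (intro dep.intros(4) disjI1 dep_ParL)
    from parL.IH[OF 3(3) this] show ?thesis
    proof (rule swappableE)
      fix A \<theta>\<^sub>1' \<theta>\<^sub>2'
      assume A: "fwd X \<theta>\<^sub>2' A" "fwd A \<theta>\<^sub>1' X''" "collapse \<theta>\<^sub>1' = collapse \<theta>"
        "collapse \<theta>\<^sub>2' = collapse (tagged \<upsilon>L (Vis l) k)" "key \<theta>\<^sub>1' = key \<theta>"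
      from A(4) obtain \<upsilon> where \<upsilon>: "\<theta>\<^sub>2' = tagged \<upsilon> (Vis l) k" by (rule collapse_eq_tagged)
      have "fwd (Par X Z) (sync \<upsilon> \<upsilon>R l k) (Par A Z')"
        by (rule fwd.syn[OF A(1)[unfolded \<upsilon>] 3(4)])
      \<comment> \<open>\<open>k\<close> is fresh for \<open>X'\<close>, which already contains
        \<open>key \<theta>\<close>. The keys must differ because \<open>Z'\<close> contains
        \<open>k\<close> by the time \<open>\<theta>\<^sub>1'\<close> is performed.\<close>
      moreover have "key \<theta> \<noteq> k"
        using key_fresh[OF 3(3)] keys_fwd[OF parL.hyps(1)] by auto
      then have "fwd (Par A Z') (Tag ParL \<theta>\<^sub>1') (Par X'' Z')"
        using A(2,5) keys_fwd[OF 3(4)] parL.hyps(2) by (simp add: fwd.parL)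
      ultimately show ?thesis unfolding 3(1,2) by (rule swappableI) (use A \<upsilon> in simp_all)
    qed
  qed
next
  case (parR X \<theta> X' Z)
  \<comment> \<open>Mirror image of the previous case: here \<open>X\<close> is the right component,
    which moves first, and \<open>Z\<close> the left one.\<close>
  from parR.prems(1) show ?case
  proof (cases rule: fwd_ParE)
    case (2 \<theta>' Y')
    have "\<not> \<theta> \<lessdot> \<theta>'"
      using parR.prems(2) unfolding 2(1) by (rule contrapos_nn) (rule dep_ParR)
    from parR.IH[OF 2(3) this] show ?thesis
      unfolding 2(1,2)
      by (rule swappableE) (rule swappableI, erule fwd.parR, simp add: 2(4), erule fwd.parR,
        simp_all add: parR.hyps(2))
  next
    case (1 \<theta>' Z')
    have "fwd (Par Z X) (Tag ParL \<theta>') (Par Z' X)"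
      using 1(3,4) keys_fwd[OF parR.hyps(1)] by (simp add: fwd.parL)
    moreover have "fwd (Par Z' X) (Tag ParR \<theta>) (Par Z' X')"
      using 1(4) parR.hyps keys_fwd[OF parR.hyps(1)] keys_fwd[OF 1(3)] by (auto intro!: fwd.parR)
    ultimately show ?thesis unfolding 1(1,2) by (rule swappableI) (rule refl)+
  next
    case (3 \<upsilon>L l k Z' \<upsilon>R X'')
    have "\<not> \<theta> \<lessdot> tagged \<upsilon>R (Vis (co l)) k"
      using parR.prems(2) unfolding 3(1) by (rule contrapos_nn) (intro dep.intros(4) disjI2 dep_ParR)
    from parR.IH[OF 3(4) this] show ?thesis
    proof (rule swappableE)
      fix A \<theta>\<^sub>1' \<theta>\<^sub>2'
      assume A: "fwd X \<theta>\<^sub>2' A" "fwd A \<theta>\<^sub>1' X''" "collapse \<theta>\<^sub>1' = collapse \<theta>"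
        "collapse \<theta>\<^sub>2' = collapse (tagged \<upsilon>R (Vis (co l)) k)" "key \<theta>\<^sub>1' = key \<theta>"
      from A(4) obtain \<upsilon> where \<upsilon>: "\<theta>\<^sub>2' = tagged \<upsilon> (Vis (co l)) k" by (rule collapse_eq_tagged)
      have "fwd (Par Z X) (sync \<upsilon>L \<upsilon> l k) (Par Z' A)"
        by (rule fwd.syn[OF 3(3) A(1)[unfolded \<upsilon>]])
      moreover have "key \<theta> \<noteq> k"
        using key_fresh[OF 3(4)] keys_fwd[OF parR.hyps(1)] by auto
      then have "fwd (Par Z' A) (Tag ParR \<theta>\<^sub>1') (Par Z' X'')"
        using A(2,5) keys_fwd[OF 3(3)] parR.hyps(2) by (simp add: fwd.parR)
      ultimately show ?thesis unfolding 3(1,2) by (rule swappableI) (use A \<upsilon> in simp_all)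
    qed
  qed
next
  case (syn X \<upsilon>L l k X' Z \<upsilon>R Z')
  from syn.prems(1) show ?case
  proof (cases rule: fwd_ParE)
    case (1 \<theta>' X'')
    \<comment> \<open>A dependency on one half of a synchronisation is a dependency on the whole, so
      the second step can be exchanged with the left half alone.\<close>
    have "\<not> tagged \<upsilon>L (Vis l) k \<lessdot> \<theta>'"
      using syn.prems(2) unfolding 1(1) by (rule contrapos_nn) (intro dep.intros(3) disjI1 dep_ParL)
    from syn.IH(1)[OF 1(3) this] show ?thesis
    proof (rule swappableE)
      fix A \<theta>\<^sub>1' \<theta>\<^sub>2'
      assume A: "fwd X \<theta>\<^sub>2' A" "fwd A \<theta>\<^sub>1' X''" "collapse \<theta>\<^sub>2' = collapse \<theta>'"
        "collapse \<theta>\<^sub>1' = collapse (tagged \<upsilon>L (Vis l) k)" "key \<theta>\<^sub>2' = key \<theta>'"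
      from A(4) obtain \<upsilon> where \<upsilon>: "\<theta>\<^sub>1' = tagged \<upsilon> (Vis l) k" by (rule collapse_eq_tagged)
      have "fwd (Par X Z) (Tag ParL \<theta>\<^sub>2') (Par A Z)"
        by (rule fwd.parL[OF A(1)]) (use A(5) keys_fwd[OF syn.hyps(2)] 1(4) in simp)
      moreover have "fwd (Par A Z) (sync \<upsilon> \<upsilon>R l k) (Par X'' Z')"
        by (rule fwd.syn[OF A(2)[unfolded \<upsilon>] syn.hyps(2)])
      ultimately show ?thesis unfolding 1(1,2) by (rule swappableI) (use A \<upsilon> in simp_all)
    qed
  next
    case (2 \<theta>' Z'')
    have "\<not> tagged \<upsilon>R (Vis (co l)) k \<lessdot> \<theta>'"
      using syn.prems(2) unfolding 2(1) by (rule contrapos_nn) (intro dep.intros(3) disjI2 dep_ParR)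
    from syn.IH(2)[OF 2(3) this] show ?thesis
    proof (rule swappableE)
      fix A \<theta>\<^sub>1' \<theta>\<^sub>2'
      assume A: "fwd Z \<theta>\<^sub>2' A" "fwd A \<theta>\<^sub>1' Z''" "collapse \<theta>\<^sub>2' = collapse \<theta>'"
        "collapse \<theta>\<^sub>1' = collapse (tagged \<upsilon>R (Vis (co l)) k)" "key \<theta>\<^sub>2' = key \<theta>'"
      from A(4) obtain \<upsilon> where \<upsilon>: "\<theta>\<^sub>1' = tagged \<upsilon> (Vis (co l)) k" by (rule collapse_eq_tagged)
      have "fwd (Par X Z) (Tag ParR \<theta>\<^sub>2') (Par X A)"
        by (rule fwd.parR[OF A(1)]) (use A(5) keys_fwd[OF syn.hyps(1)] 2(4) in simp)
      moreover have "fwd (Par X A) (sync \<upsilon>L \<upsilon> l k) (Par X' Z'')"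
        by (rule fwd.syn[OF syn.hyps(1) A(2)[unfolded \<upsilon>]])
      ultimately show ?thesis unfolding 2(1,2) by (rule swappableI) (use A \<upsilon> in simp_all)
    qed
  next
    case (3 \<upsilon>L' l' k' X'' \<upsilon>R' Z'')
    \<comment> \<open>For two synchronisations a dependency in either component suffices, so
      independence holds in both. The two squares are closed separately and then recombined.\<close>
    have "\<not> tagged \<upsilon>L (Vis l) k \<lessdot> tagged \<upsilon>L' (Vis l') k'"
      using syn.prems(2) unfolding 3(1)
      by (rule contrapos_nn) (intro dep.intros(5) disjI1 dep_ParL)
    moreover have "\<not> tagged \<upsilon>R (Vis (co l)) k \<lessdot> tagged \<upsilon>R' (Vis (co l')) k'"
      using syn.prems(2) unfolding 3(1)
      by (rule contrapos_nn) (intro dep.intros(5) disjI2 dep_ParR)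
    ultimately have "swappable X (tagged \<upsilon>L (Vis l) k) (tagged \<upsilon>L' (Vis l') k') X''"
      "swappable Z (tagged \<upsilon>R (Vis (co l)) k) (tagged \<upsilon>R' (Vis (co l')) k') Z''"
      using syn.IH 3(3,4) by blast+
    then obtain A B \<upsilon>\<^sub>1 \<upsilon>\<^sub>2 \<upsilon>\<^sub>3 \<upsilon>\<^sub>4 where w:
      "fwd X (tagged \<upsilon>\<^sub>1 (Vis l') k') A" "fwd A (tagged \<upsilon>\<^sub>2 (Vis l) k) X''"
      "fwd Z (tagged \<upsilon>\<^sub>3 (Vis (co l')) k') B" "fwd B (tagged \<upsilon>\<^sub>4 (Vis (co l)) k) Z''"
      "collapse (tagged \<upsilon>\<^sub>1 (Vis l') k') = collapse (tagged \<upsilon>L' (Vis l') k')"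
      "collapse (tagged \<upsilon>\<^sub>2 (Vis l) k) = collapse (tagged \<upsilon>L (Vis l) k)"
      "collapse (tagged \<upsilon>\<^sub>3 (Vis (co l')) k') = collapse (tagged \<upsilon>R' (Vis (co l')) k')"
      "collapse (tagged \<upsilon>\<^sub>4 (Vis (co l)) k) = collapse (tagged \<upsilon>R (Vis (co l)) k)"
      by (elim swappable_taggedE) blast
    show ?thesis unfolding 3(1,2)
      by (rule swappableI[OF fwd.syn[OF w(1,3)] fwd.syn[OF w(2,4)]]) (simp_all add: w(5-8))
  qed
next
  case (sumL X \<theta> X' Z)
  \<comment> \<open>The first step has left a key in \<open>X'\<close>, so the second cannot choose
    the other summand.\<close>
  have "\<not> std X'" using keys_fwd[OF sumL.hyps(1)] by (auto simp: std_def)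
  with sumL.prems(1) obtain Y' where Y: "Y = Sum Y' Z" "fwd X' \<theta>\<^sub>2 Y'"
    by (elim fwd_SumE) blast+
  from sumL.IH[OF Y(2) sumL.prems(2)] show ?case
    by (rule swappableE) (use Y sumL.hyps in \<open>fastforce intro: swappableI fwd.sumL\<close>)
next
  case (sumR X \<theta> X' Z)
  have "\<not> std X'" using keys_fwd[OF sumR.hyps(1)] by (auto simp: std_def)
  with sumR.prems(1) obtain Y' where Y: "Y = Sum Z Y'" "fwd X' \<theta>\<^sub>2 Y'"
    by (elim fwd_SumE) blast+
  from sumR.IH[OF Y(2) sumR.prems(2)] show ?case
    by (rule swappableE) (use Y sumR.hyps in \<open>fastforce intro: swappableI fwd.sumR\<close>)
next
  case (repl1 X \<theta> X')
  \<comment> \<open>A step of the remaining \<open>Repl X\<close>, alone or as half of a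
    synchronisation, has or contains a label tagged \<open>ParL\<close>, and so depends on the
    unfolding.\<close>
  from repl1.prems obtain \<theta>' X'' where Y: "Y = Par (Repl X) X''" "\<theta>\<^sub>2 = Tag ParR \<theta>'" "fwd X' \<theta>' X''"
    by (elim fwd_ParE) (blast intro: dep.intros(4,7))+
  with repl1.prems(2) have "\<not> \<theta> \<lessdot> \<theta>'" by (blast intro: dep.intros(10))
  from repl1.IH[OF Y(3) this] show ?case
    by (rule swappableE)
      \<comment> \<open>Freshness for \<open>X\<close> is the side condition of \<open>parR\<close>
        for the formerly first step, now performed beside \<open>Repl X\<close>.\<close>
      (use Y key_fresh[OF repl1.hyps] in \<open>fastforce intro: swappableI fwd.repl1 fwd.parR\<close>)
next
  case (repl2 X \<upsilon>L l k X' \<upsilon>R X'')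
  from repl2.prems(1) obtain \<theta>' Z where Y: "Y = Par (Repl X) Z" "\<theta>\<^sub>2 = Tag ParR \<theta>'"
    "fwd (Par X' X'') \<theta>' Z"
  proof (cases rule: fwd_ParE)
    case (2 \<theta>' Z)
    with that show ?thesis by blast
  qed (use repl2.prems(2) in \<open>simp_all add: dep.intros(4,7)\<close>)
  \<comment> \<open>A step of just one of the two copies depends on the synchronised unfolding by
    \<open>dep.intros(8,9)\<close>, so both copies must take part.\<close>
  from Y(3) obtain \<upsilon>L' l' k' Y' \<upsilon>R' Y'' where
    Z: "Z = Par Y' Y''" "\<theta>' = sync \<upsilon>L' \<upsilon>R' l' k'"
      "fwd X' (tagged \<upsilon>L' (Vis l') k') Y'" "fwd X'' (tagged \<upsilon>R' (Vis (co l')) k') Y''"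
  proof (cases rule: fwd_ParE)
    case 3
    with that show ?thesis by blast
  qed (use repl2.prems(2) in \<open>simp_all add: Y(2) dep.intros(8,9)\<close>)
  have "\<not> tagged \<upsilon>L (Vis l) k \<lessdot> tagged \<upsilon>L' (Vis l') k'"
    using repl2.prems(2) unfolding Y(2) Z(2)
    by (rule contrapos_nn) (intro dep.intros(10) dep.intros(5) disjI1 dep_ParL)
  moreover have "\<not> tagged \<upsilon>R (Vis (co l)) k \<lessdot> tagged \<upsilon>R' (Vis (co l')) k'"
    using repl2.prems(2) unfolding Y(2) Z(2)
    by (rule contrapos_nn) (intro dep.intros(10) dep.intros(5) disjI2 dep_ParR)
  ultimately have "swappable X (tagged \<upsilon>L (Vis l) k) (tagged \<upsilon>L' (Vis l') k') Y'"
    "swappable X (tagged \<upsilon>R (Vis (co l)) k) (tagged \<upsilon>R' (Vis (co l')) k') Y''"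
    using repl2.IH Z(3,4) by blast+
  then obtain A B \<upsilon>\<^sub>1 \<upsilon>\<^sub>2 \<upsilon>\<^sub>3 \<upsilon>\<^sub>4 where w:
    "fwd X (tagged \<upsilon>\<^sub>1 (Vis l') k') A" "fwd A (tagged \<upsilon>\<^sub>2 (Vis l) k) Y'"
    "fwd X (tagged \<upsilon>\<^sub>3 (Vis (co l')) k') B" "fwd B (tagged \<upsilon>\<^sub>4 (Vis (co l)) k) Y''"
    "collapse (tagged \<upsilon>\<^sub>1 (Vis l') k') = collapse (tagged \<upsilon>L' (Vis l') k')"
    "collapse (tagged \<upsilon>\<^sub>2 (Vis l) k) = collapse (tagged \<upsilon>L (Vis l) k)"
    "collapse (tagged \<upsilon>\<^sub>3 (Vis (co l')) k') = collapse (tagged \<upsilon>R' (Vis (co l')) k')"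
    "collapse (tagged \<upsilon>\<^sub>4 (Vis (co l)) k) = collapse (tagged \<upsilon>R (Vis (co l)) k)"
    by (elim swappable_taggedE) blast
  \<comment> \<open>Both exchanges start from the same \<open>X\<close>, as the two premises of
    \<open>repl2\<close> demand.\<close>
  have "fwd (Repl X) (Tag Bang (sync \<upsilon>\<^sub>1 \<upsilon>\<^sub>3 l' k')) (Par (Repl X) (Par A B))"
    using w(1,3) by (rule fwd.repl2)
  moreover have "fwd (Par (Repl X) (Par A B)) (Tag ParR (sync \<upsilon>\<^sub>2 \<upsilon>\<^sub>4 l k)) (Par (Repl X) (Par Y' Y''))"
    using key_fresh[OF repl2.hyps(1)] by (intro fwd.parR fwd.syn w) simp
  ultimately show ?case unfolding Y(1,2) Z(1,2)
    by (rule swappableI) (simp_all add: w(5-8))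
qed

theorem theorem5:
  fixes X X\<^sub>1 Y :: "('n, 'k) proc" and \<theta>\<^sub>1 \<theta>\<^sub>2 :: "('n, 'k) elabel"
  assumes "reachable X" and "reachable X\<^sub>1" and "reachable Y"
    and "fwd X \<theta>\<^sub>1 X\<^sub>1" and "fwd X\<^sub>1 \<theta>\<^sub>2 Y"
    and "concurrent_in [(X, \<theta>\<^sub>1, X\<^sub>1), (X\<^sub>1, \<theta>\<^sub>2, Y)] 0 1"
  shows "\<exists>X\<^sub>2 \<theta>\<^sub>1' \<theta>\<^sub>2'. reachable X\<^sub>2 \<and> fwd X \<theta>\<^sub>2' X\<^sub>2 \<and> fwd X\<^sub>2 \<theta>\<^sub>1' Y \<and>
           collapse \<theta>\<^sub>1' = collapse \<theta>\<^sub>1 \<and> collapse \<theta>\<^sub>2' = collapse \<theta>\<^sub>2"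
proof -
  have "\<not> \<theta>\<^sub>1 \<lessdot> \<theta>\<^sub>2"
    using assms(6) by (simp add: concurrent_in_def dep_in_def label_at_def)
  from swap[OF assms(4,5) this] obtain X\<^sub>2 \<theta>\<^sub>1' \<theta>\<^sub>2' where *: "fwd X \<theta>\<^sub>2' X\<^sub>2" "fwd X\<^sub>2 \<theta>\<^sub>1' Y"
    "collapse \<theta>\<^sub>1' = collapse \<theta>\<^sub>1" "collapse \<theta>\<^sub>2' = collapse \<theta>\<^sub>2"
    by (rule swappableE)
  have "reachable X\<^sub>2"
    using assms(1) *(1) unfolding reachable_def
    by (metis (mono_tags, lifting) rtranclp.rtrancl_into_rtrancl step_def)
  with * show ?thesis by blast
qed

end
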